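(* Let $X, M \in \mathbb{Z}$ with $M \ge 2$. Let $P, Q \in \mathbb{N}$ be positive (bounds for numerator and denominator respectively). Suppose there exists a factorization $M = M_{\mathrm{good}} \, M_{\mathrm{bad}}$ with $M_{\mathrm{good}}, M_{\mathrm{bad}}$ positive integers such that $2 P Q M_{\mathrm{bad}}^2 < M$, and suppose also that there exists a rational $p/q \in \mathbb{Q}$ (with $p,q\in\mathbb{Z}$) with $|p| \le P$ and $1 \le q \le Q$ which satisfies $p \equiv qX \pmod{M_{\mathrm{good}}}$. Then the rational number $\frac{p}{q}$ is unique, and is given by $$\frac{p}{q} = X - M \cdot \frac{R}{S},$$ where $\frac{R}{S}$ is the last continued fraction approximant to $\frac{X}{M}$ with denominator $\le Q M_{\mathrm{bad}}$. Moreover, if $p \neq 0$, the next continued fraction approximant to $\frac{X}{M}$ after $\frac{R}{S}$ has denominator $> \frac{M_{\mathrm{good}}}{2|p|}$.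
   Context: A rational $x$ has a finite continued fraction $x=[a_0,a_1,\ldots,a_n]$, with all $a_j \in \mathbb{Z}$ and $a_j>0$ for $j>0$; the expansion used is the one produced by the Euclidean algorithm, i.e. with $a_n \ge 2$ if $n \ge 1$. The $k$-th continued fraction approximant to $x$ ($k=0,1,\ldots,n$) is the rational $r_k/s_k$, in lowest terms with $s_k>0$, whose continued fraction is $[a_0,a_1,\ldots,a_k]$. "Last" and "next" refer to the order of the index $k$. *)

theory Defs
  imports Complex_Main "HOL-Number_Theory.Cong"
begin

(* Partial quotients of a / b.  The last nonempty step is the exact division, so no extra
   partial quotient 1 is ever split off at the end (see euclid_cf_last below). *)
function euclid_cf :: "int \<Rightarrow> int \<Rightarrow> int list" where
  "euclid_cf a b = (if b \<le> 0 then [] else (a div b) # euclid_cf b (a mod b))"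
  by pat_completeness auto
termination
  by (relation "measure (\<lambda>(a, b). nat b)") auto

declare euclid_cf.simps [simp del]

definition cf_expansion :: "rat \<Rightarrow> int list" where
  "cf_expansion x = (case quotient_of x of (a, b) \<Rightarrow> euclid_cf a b)"

(* The index n of the last partial quotient in x = [a_0, ..., a_n]. *)
definition cf_last_index :: "rat \<Rightarrow> nat" where
  "cf_last_index x = length (cf_expansion x) - 1"

(* The value of [a_0, ..., a_k]; the empty list is a dummy case. *)
fun cf_value :: "int list \<Rightarrow> rat" where
  "cf_value [] = 0"
| "cf_value [a] = of_int a"
| "cf_value (a # b # as) = of_int a + 1 / cf_value (b # as)"

(* Meaningful for k \<le> cf_last_index x only. *)
definition cf_approximant :: "rat \<Rightarrow> nat \<Rightarrow> rat" where
  "cf_approximant x k = cf_value (take (Suc k) (cf_expansion x))"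

definition cf_denom :: "rat \<Rightarrow> nat \<Rightarrow> int" where
  "cf_denom x k = snd (quotient_of (cf_approximant x k))"

definition is_last_approximant_le :: "rat \<Rightarrow> int \<Rightarrow> nat \<Rightarrow> bool" where
  "is_last_approximant_le x B k \<longleftrightarrow>
     k \<le> cf_last_index x \<and> cf_denom x k \<le> B \<and>
     (\<forall>j. k < j \<and> j \<le> cf_last_index x \<longrightarrow> \<not> cf_denom x j \<le> B)"

definition admissible :: "int \<Rightarrow> int \<Rightarrow> nat \<Rightarrow> nat \<Rightarrow> int \<Rightarrow> int \<Rightarrow> bool" where
  "admissible X Mgood P Q p q \<longleftrightarrow>
     \<bar>p\<bar> \<le> int P \<and> 1 \<le> q \<and> q \<le> int Q \<and> [p = q * X] (mod Mgood)"

(* Correctness of the expansion: it evaluates to x, all partial quotients after the first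
   are positive, and the last one is at least 2 unless it is the only one. *)

lemma euclid_cf_ne: "b > 0 \<Longrightarrow> euclid_cf a b \<noteq> []"
  by (subst euclid_cf.simps) simp

lemma euclid_cf_value: "b > 0 \<Longrightarrow> cf_value (euclid_cf a b) = of_int a / of_int b"
proof (induction a b rule: euclid_cf.induct)
  case (1 a b)
  have eq: "euclid_cf a b = (a div b) # euclid_cf b (a mod b)"
    using 1(2) by (subst euclid_cf.simps) simp
  have dm: "(of_int a :: rat) = of_int b * of_int (a div b) + of_int (a mod b)"
    by (metis mult_div_mod_eq of_int_add of_int_mult)
  show ?case
  proof (cases "a mod b > 0")
    case True
    then obtain c cs where c: "euclid_cf b (a mod b) = c # cs"
      using euclid_cf_ne[of "a mod b" b] by (cases "euclid_cf b (a mod b)") auto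
    have "cf_value (c # cs) = of_int b / of_int (a mod b)"
      using 1 True c by simp
    then have "cf_value (euclid_cf a b) = of_int (a div b) + of_int (a mod b) / of_int b"
      using eq c by simp
    then show ?thesis using dm 1(2) by (simp add: field_simps)
  next
    case False
    then have "a mod b = 0" using 1(2) pos_mod_sign[of b a] by linarith
    moreover have "euclid_cf b 0 = []" by (subst euclid_cf.simps) simp
    ultimately show ?thesis using eq dm 1(2) by (simp add: field_simps)
  qed
qed

lemma euclid_cf_pos: "0 < b \<Longrightarrow> b \<le> a \<Longrightarrow> c \<in> set (euclid_cf a b) \<Longrightarrow> c > 0"
proof (induction a b rule: euclid_cf.induct)
  case (1 a b)
  have eq: "euclid_cf a b = (a div b) # euclid_cf b (a mod b)"
    using 1(2) by (subst euclid_cf.simps) simp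
  have "c = a div b \<or> c \<in> set (euclid_cf b (a mod b))" using 1(4) eq by simp
  then show ?case
  proof
    assume "c = a div b"
    then show ?thesis using 1(2,3) by (simp add: pos_imp_zdiv_pos_iff)
  next
    assume h: "c \<in> set (euclid_cf b (a mod b))"
    then have "a mod b > 0"
      by (subst (asm) euclid_cf.simps) (auto split: if_splits)
    then show ?thesis using 1 h pos_mod_bound[of b a] by (simp add: less_imp_le)
  qed
qed

lemma euclid_cf_tl_pos: "0 < b \<Longrightarrow> c \<in> set (tl (euclid_cf a b)) \<Longrightarrow> c > 0"
proof -
  assume b: "0 < b" and c: "c \<in> set (tl (euclid_cf a b))"
  have eq: "euclid_cf a b = (a div b) # euclid_cf b (a mod b)"
    using b by (subst euclid_cf.simps) simp
  have h: "c \<in> set (euclid_cf b (a mod b))" using c eq by simp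
  then have "a mod b > 0"
    by (subst (asm) euclid_cf.simps) (auto split: if_splits)
  then show "c > 0"
    using euclid_cf_pos[OF _ _ h] b pos_mod_bound[of b a] by (simp add: less_imp_le)
qed

lemma euclid_cf_last:
  "0 < b \<Longrightarrow> b < a \<or> length (euclid_cf a b) > 1 \<Longrightarrow> last (euclid_cf a b) \<ge> 2"
proof (induction a b rule: euclid_cf.induct)
  case (1 a b)
  have eq: "euclid_cf a b = (a div b) # euclid_cf b (a mod b)"
    using 1(2) by (subst euclid_cf.simps) simp
  show ?case
  proof (cases "a mod b > 0")
    case True
    then show ?thesis
      using 1 eq euclid_cf_ne[OF True, of b] pos_mod_bound[of b a] by simp
  next
    case False
    then have z: "a mod b = 0" using 1(2) pos_mod_sign[of b a] by linarith
    have e: "euclid_cf b 0 = []" by (subst euclid_cf.simps) simp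
    have "b < a" using 1(3) eq z e by simp
    moreover have "a = b * (a div b)" using z by auto
    ultimately have "b * 1 < b * (a div b)" by simp
    then have "a div b > 1" using 1(2) by (simp add: mult_less_cancel_left_pos)
    then show ?thesis using eq z e by simp
  qed
qed

lemma cf_value_expansion: "cf_value (cf_expansion x) = x"
  using euclid_cf_value quotient_of_denom_pos quotient_of_div
  by (fastforce simp: cf_expansion_def split: prod.splits)

lemma cf_expansion_pos: "c \<in> set (tl (cf_expansion x)) \<Longrightarrow> c > 0"
  using euclid_cf_tl_pos quotient_of_denom_pos
  by (fastforce simp: cf_expansion_def split: prod.splits)

lemma cf_expansion_last: "cf_last_index x \<ge> 1 \<Longrightarrow> last (cf_expansion x) \<ge> 2"
  using euclid_cf_last quotient_of_denom_pos
  by (fastforce simp: cf_expansion_def cf_last_index_def split: prod.splits)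

end

theory Submission
  imports Defs
begin

text \<open>
  Write \<open>q X - p = Mgood t\<close> and \<open>u = q Mbad\<close>, so that \<open>u \<le> Q Mbad\<close>. With \<open>x = X / M\<close> one gets
  \<open>u x - t = p / Mgood\<close> and \<open>p / q = X - M (t / u)\<close>. A small solution \<open>(p, q)\<close> of the congruence
  therefore yields a fraction \<open>t / u\<close> with bounded denominator that approximates \<open>x\<close> well:
  with \<open>B = Q Mbad\<close> the hypothesis \<open>2 P Q Mbad\<^sup>2 < M\<close> gives \<open>2 B \<bar>u x - t\<bar> < 1\<close>.

  Everything then rests on \<open>good_approximation_is_last_approximant\<close>: such a fraction equals the last
  approximant \<open>R / S\<close> of \<open>x\<close> with \<open>S \<le> B\<close>. If there is a next approximant, its denominator exceeds
  \<open>B \<ge> u\<close>, so the best approximation property (\<open>approximant_best\<close>) gives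
  \<open>\<bar>S x - R\<bar> \<le> \<bar>u x - t\<bar>\<close>; otherwise \<open>R / S = x\<close> and this is trivial. The integer
  \<open>t S - R u = u (S x - R) - S (u x - t)\<close> is then at most \<open>2 B \<bar>u x - t\<bar> < 1\<close> in absolute value,
  hence zero. Uniqueness of \<open>p / q\<close> follows because \<open>R / S\<close> depends only on \<open>x\<close> and \<open>B\<close>.

  The bound on the next denominator \<open>S'\<close> comes from \<open>1 < 2 S' \<bar>S x - R\<bar>\<close>
  (\<open>approximant_defect_lower\<close>), which combines the determinant \<open>R' S - R S' = \<plusminus>1\<close> with the fact that
  the defects \<open>S x - R\<close> shrink strictly in absolute value. Best approximation uses that
  they alternate in sign. Both facts hold because, up to sign and scaling, the defects are the
  remainders of the Euclidean algorithm (\<open>euclid_cf_remainders\<close>).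
\<close>

section \<open>Numerators and denominators of continued fractions\<close>

text \<open>The empty expansion has numerator 1 and denominator 0. It plays the part of the customary
  approximant of index -1, so that an induction over prefixes can start from it.\<close>

fun cf_num :: "int list \<Rightarrow> int" and cf_den :: "int list \<Rightarrow> int" where
  "cf_num [] = 1"
| "cf_num (a # as) = a * cf_num as + cf_den as"
| "cf_den [] = 0"
| "cf_den (a # as) = cf_num as"

lemma coprime_cf_num_den: "coprime (cf_num as) (cf_den as)"
proof (induction as)
  case (Cons a as)
  have "gcd (cf_num (a # as)) (cf_den (a # as)) = gcd (cf_num as) (a * cf_num as + cf_den as)"
    by (simp add: gcd.commute)
  also have "\<dots> = gcd (cf_num as) (cf_den as)" by (rule gcd_add_mult)
  finally show ?case using Cons by (simp only: coprime_iff_gcd_eq_1)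
qed simp

lemma cf_num_den_pos:
  assumes "\<forall>c\<in>set as. c > 0"
  shows "cf_num as > 0 \<and> cf_den as \<ge> 0"
  using assms by (induction as) (auto simp: add_pos_nonneg)

lemma cf_den_pos:
  assumes "\<forall>c\<in>set (tl as). c > 0" and "as \<noteq> []"
  shows "cf_den as > 0"
  using assms cf_num_den_pos by (cases as) auto

lemma cf_value_eq_num_div_den:
  assumes "\<forall>c\<in>set (tl as). c > 0" and "as \<noteq> []"
  shows "cf_value as = of_int (cf_num as) / of_int (cf_den as)"
  using assms
proof (induction as rule: cf_value.induct)
  case (3 a b as)
  have "cf_num (b # as) > 0" using 3(2) cf_num_den_pos[of "b # as"] by simp
  moreover have "cf_value (b # as) = of_int (cf_num (b # as)) / of_int (cf_den (b # as))"
    using 3 by simp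
  ultimately show ?case
    by (simp only: cf_value.simps cf_num.simps(2)[of a] cf_den.simps(2)[of a])
       (simp add: divide_simps del: cf_num.simps cf_den.simps)
qed simp_all

lemma quotient_of_cf_value:
  assumes "\<forall>c\<in>set (tl as). c > 0" and "as \<noteq> []"
  shows "quotient_of (cf_value as) = (cf_num as, cf_den as)"
  unfolding cf_value_eq_num_div_den[OF assms] Fract_of_int_quotient[symmetric] quotient_of_Fract
  by (rule normalize_stable[OF cf_den_pos[OF assms] coprime_cf_num_den])

text \<open>Numerators and denominators have to be treated together, because the recursion for one
  involves the other. The first entry must be positive for the numerators to increase from 1.\<close>

lemma cf_num_den_mono:
  assumes "\<forall>c\<in>set as. c > 0"
  shows "cf_num (take k as) \<le> cf_num (take (Suc k) as) \<and>
         cf_den (take k as) \<le> cf_den (take (Suc k) as)"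
  using assms
proof (induction as arbitrary: k)
  case (Cons a as)
  show ?case
  proof (cases k)
    case 0
    then show ?thesis using Cons(2) by simp
  next
    case (Suc j)
    with Cons.IH[of j] Cons(2) show ?thesis
      by (simp add: add_mono mult_left_mono)
  qed
qed simp

text \<open>The first partial quotient of a rational may be zero or negative, but it does not enter the
  denominators: these are numerators of the remaining, positive expansion.\<close>

lemma cf_den_mono_step:
  assumes "\<forall>c\<in>set (tl as). c > 0"
  shows "cf_den (take k as) \<le> cf_den (take (Suc k) as)"
proof (cases as)
  case (Cons a bs)
  then show ?thesis using assms cf_num_den_mono[of bs] by (cases k) auto
qed simp

lemma cf_den_mono:
  assumes "\<forall>c\<in>set (tl as). c > 0" and "i \<le> j"
  shows "cf_den (take i as) \<le> cf_den (take j as)"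
  using cf_den_mono_step[OF assms(1)] assms(2)
  by (rule lift_Suc_mono_le[of "\<lambda>k. cf_den (take k as)"])

lemma cf_determinant:
  assumes "k < length as"
  shows "cf_num (take (Suc k) as) * cf_den (take k as)
       - cf_num (take k as) * cf_den (take (Suc k) as) = (- 1) ^ Suc k"
  using assms
proof (induction as arbitrary: k)
  case (Cons a as)
  then show ?case
    by (cases k) (auto simp: algebra_simps)
qed simp

section \<open>Euclidean remainders\<close>

text \<open>Up to sign, \<open>D a - N b\<close> for successive prefixes \<open>N / D\<close> of the expansion runs through
  \<open>b, a mod b, \<dots>\<close>, that is, through the divisors and remainders of the Euclidean algorithm.
  This gives the alternating signs and the strict decrease at once. Replacing \<open>(a, b)\<close> by
  \<open>(b, a mod b)\<close> shifts the index by one and flips the sign, which is the induction step.\<close>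

lemma euclid_cf_remainders:
  assumes "b > 0" and "k < length (euclid_cf a b)"
  shows "0 < (- 1) ^ Suc k * (cf_den (take k (euclid_cf a b)) * a
                            - cf_num (take k (euclid_cf a b)) * b) \<and>
    0 \<le> (- 1) ^ k * (cf_den (take (Suc k) (euclid_cf a b)) * a
                       - cf_num (take (Suc k) (euclid_cf a b)) * b) \<and>
    (- 1) ^ k * (cf_den (take (Suc k) (euclid_cf a b)) * a
               - cf_num (take (Suc k) (euclid_cf a b)) * b)
    < (- 1) ^ Suc k * (cf_den (take k (euclid_cf a b)) * a
                     - cf_num (take k (euclid_cf a b)) * b)"
  using assms
proof (induction k arbitrary: a b)
  case 0
  have eq: "euclid_cf a b = (a div b) # euclid_cf b (a mod b)"
    using 0 by (subst euclid_cf.simps) simp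
  have "a - a div b * b = a mod b" by (simp add: minus_div_mult_eq_mod)
  then show ?case using 0 by (simp add: eq)
next
  case (Suc k)
  define cs where "cs = euclid_cf b (a mod b)"
  have eq: "euclid_cf a b = (a div b) # cs"
    using Suc(2) by (subst euclid_cf.simps) (simp add: cs_def)
  have len: "k < length cs" using Suc(3) eq by simp
  then have "a mod b > 0"
    unfolding cs_def by (subst (asm) euclid_cf.simps) (auto split: if_splits)
  note IH = Suc.IH[OF this, of b, folded cs_def, OF len]
  have sgn: "(- 1) ^ Suc i * - z = (- 1) ^ i * z" for i and z :: int by simp
  have a: "a = a div b * b + a mod b" by simp
  have step: "cf_den (take (Suc j) (euclid_cf a b)) * a - cf_num (take (Suc j) (euclid_cf a b)) * b
     = - (cf_den (take j cs) * b - cf_num (take j cs) * (a mod b))" for j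
    by (simp add: eq minus_div_mult_eq_mod[symmetric] algebra_simps)
  show ?case using IH unfolding eq[symmetric] step sgn .
qed

section \<open>Approximants of a rational number\<close>

lemma cf_expansion_nonempty: "cf_expansion x \<noteq> []"
  using euclid_cf_ne quotient_of_denom_pos
  by (fastforce simp: cf_expansion_def split: prod.splits)

definition approximant_num :: "rat \<Rightarrow> nat \<Rightarrow> int" where
  "approximant_num x k = cf_num (take (Suc k) (cf_expansion x))"

lemma quotient_of_cf_approximant:
  "quotient_of (cf_approximant x k) = (approximant_num x k, cf_den (take (Suc k) (cf_expansion x)))"
proof -
  have "\<forall>c\<in>set (tl (take (Suc k) (cf_expansion x))). c > 0"
    using cf_expansion_pos[of _ x] by (metis in_set_takeD take_tl)
  moreover have "take (Suc k) (cf_expansion x) \<noteq> []" using cf_expansion_nonempty by simp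
  ultimately show ?thesis
    unfolding cf_approximant_def approximant_num_def by (rule quotient_of_cf_value)
qed

lemma cf_denom_eq: "cf_denom x k = cf_den (take (Suc k) (cf_expansion x))"
  by (simp add: cf_denom_def quotient_of_cf_approximant)

lemma cf_denom_pos: "cf_denom x k > 0"
  unfolding cf_denom_def by (metis prod.collapse quotient_of_denom_pos)

lemma cf_denom_zero: "cf_denom x 0 = 1"
  using cf_expansion_nonempty[of x] by (cases "cf_expansion x") (auto simp: cf_denom_eq)

lemma cf_denom_mono: "i \<le> j \<Longrightarrow> cf_denom x i \<le> cf_denom x j"
  unfolding cf_denom_eq using cf_expansion_pos by (intro cf_den_mono) auto

lemma cf_approximant_eq_div:
  "cf_approximant x k = of_int (approximant_num x k) / of_int (cf_denom x k)"
  using quotient_of_div[OF quotient_of_cf_approximant] by (simp add: cf_denom_eq)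

lemma cf_approximant_last: "cf_approximant x (cf_last_index x) = x"
  using cf_expansion_nonempty[of x]
  by (simp add: cf_approximant_def cf_last_index_def cf_value_expansion)

lemma approximant_determinant:
  assumes "k < cf_last_index x"
  shows "\<bar>approximant_num x (Suc k) * cf_denom x k
        - approximant_num x k * cf_denom x (Suc k)\<bar> = 1"
proof -
  have "Suc k < length (cf_expansion x)" using assms by (simp add: cf_last_index_def)
  from cf_determinant[OF this] show ?thesis
    by (simp add: approximant_num_def cf_denom_eq abs_mult power_abs)
qed

text \<open>Measuring the error as \<open>S x - R\<close> instead of \<open>x - R / S\<close> makes it linear in \<open>(R, S)\<close>, as the
  lattice argument for best approximation requires.\<close>

definition approximant_defect :: "rat \<Rightarrow> nat \<Rightarrow> rat" where
  "approximant_defect x k = of_int (cf_denom x k) * x - of_int (approximant_num x k)"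

lemma approximant_defects:
  assumes "k < cf_last_index x"
  shows "approximant_defect x k * approximant_defect x (Suc k) \<le> 0"
    and "\<bar>approximant_defect x (Suc k)\<bar> < \<bar>approximant_defect x k\<bar>"
proof -
  obtain a b where ab: "quotient_of x = (a, b)" by fastforce
  have b: "b > 0" using quotient_of_denom_pos[OF ab] .
  have x: "x = of_int a / of_int b" using quotient_of_div[OF ab] .
  have cs: "cf_expansion x = euclid_cf a b" by (simp add: cf_expansion_def ab)
  define e where "e j = cf_denom x j * a - approximant_num x j * b" for j
  have defect: "approximant_defect x j = of_int (e j) / of_int b" for j
    using b by (simp add: approximant_defect_def e_def x field_simps)
  have "Suc k < length (euclid_cf a b)" using assms by (simp add: cf_last_index_def cs)
  note rem = euclid_cf_remainders[OF b this]
  have r: "0 < (- 1) ^ k * e k" "(- 1) ^ k * e (Suc k) \<le> 0"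
    "- ((- 1) ^ k * e (Suc k)) < (- 1) ^ k * e k"
    using rem by (simp_all add: e_def approximant_num_def cf_denom_eq cs)
  have "e k * e (Suc k) \<le> 0 \<and> \<bar>e (Suc k)\<bar> < \<bar>e k\<bar>"
    using r by (cases "even k") (auto simp: mult_le_0_iff)
  then have i: "of_int (e k * e (Suc k)) \<le> (0::rat)" "of_int \<bar>e (Suc k)\<bar> < (of_int \<bar>e k\<bar> :: rat)"
    by (simp_all only: of_int_le_0_iff of_int_less_iff)
  show "approximant_defect x k * approximant_defect x (Suc k) \<le> 0"
    using i(1) b by (simp add: defect divide_le_0_iff)
  show "\<bar>approximant_defect x (Suc k)\<bar> < \<bar>approximant_defect x k\<bar>"
    using i(2) b by (simp add: defect abs_divide divide_strict_right_mono)
qed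

section \<open>Best approximation\<close>

text \<open>Both products \<open>e e'\<close> and \<open>\<alpha> \<beta>\<close> being nonpositive, the terms \<open>\<alpha> e\<close> and \<open>\<beta> e'\<close> never have
  opposite signs, so they cannot cancel, and \<open>\<bar>\<alpha>\<bar> \<ge> 1\<close>.\<close>

lemma abs_lattice_combination_ge:
  fixes e e' :: rat and \<alpha> \<beta> :: int
  assumes "e * e' \<le> 0" and "\<alpha> \<noteq> 0" and "\<alpha> * \<beta> \<le> 0"
  shows "\<bar>e\<bar> \<le> \<bar>of_int \<alpha> * e + of_int \<beta> * e'\<bar>"
proof -
  have "0 \<le> (e * e') * of_int (\<alpha> * \<beta>)"
    using assms(1,3) by (intro mult_nonpos_nonpos) (simp_all only: of_int_le_0_iff)
  then have "0 \<le> (of_int \<alpha> * e) * (of_int \<beta> * e')" by (simp add: mult_ac)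
  then have "\<bar>of_int \<alpha> * e\<bar> \<le> \<bar>of_int \<alpha> * e + of_int \<beta> * e'\<bar>"
    by (auto simp: zero_le_mult_iff)
  moreover have "1 * \<bar>e\<bar> \<le> of_int \<bar>\<alpha>\<bar> * \<bar>e\<bar>"
    using assms(2) by (intro mult_right_mono) (simp_all del: of_int_abs)
  ultimately show ?thesis by (simp add: abs_mult)
qed

text \<open>Two consecutive approximants form a basis of the integer lattice, so \<open>(t, u)\<close> is an integer
  combination of them with coefficients \<open>\<alpha>, \<beta>\<close>. With \<open>D'\<close> the later denominator,
  the constraint \<open>0 < u < D'\<close> forces \<open>\<alpha>\<close> and \<open>\<beta>\<close> to have opposite signs (or \<open>\<beta> = 0\<close>), and the two defects have opposite signs as well.\<close>

lemma approximant_best: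
  assumes k: "k < cf_last_index x" and u: "0 < u" "u < cf_denom x (Suc k)"
  shows "\<bar>approximant_defect x k\<bar> \<le> \<bar>of_int u * x - of_int t\<bar>"
proof -
  define N D N' D' where "N = approximant_num x k" and "D = cf_denom x k"
    and "N' = approximant_num x (Suc k)" and "D' = cf_denom x (Suc k)"
  define s where "s = N' * D - N * D'"
  have "\<bar>s\<bar> = 1" using approximant_determinant[OF k] by (simp add: s_def N_def N'_def D_def D'_def)
  then have ss: "s * s = 1" by (metis abs_mult_self_eq mult_1)
  have D: "D > 0" "D' > 0" using cf_denom_pos by (simp_all add: D_def D'_def)
  \<comment> \<open>Cramer's rule; \<open>s\<close> is its own inverse, so it replaces the division by the determinant.\<close>
  define \<alpha> \<beta> where "\<alpha> = s * (u * N' - t * D')" and "\<beta> = s * (t * D - u * N)"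
  have "\<alpha> * D + \<beta> * D' = s * s * u" "\<alpha> * N + \<beta> * N' = s * s * t"
    by (simp_all add: \<alpha>_def \<beta>_def s_def algebra_simps)
  then have ut: "u = \<alpha> * D + \<beta> * D'" "t = \<alpha> * N + \<beta> * N'" using ss by simp_all
  have "\<alpha> \<noteq> 0 \<and> \<alpha> * \<beta> \<le> 0"
  proof (cases "\<beta> \<le> 0")
    case True
    then have "\<beta> * D' \<le> 0" using D by (simp add: mult_le_0_iff)
    then have "\<alpha> * D > 0" using u ut by linarith
    then have "\<alpha> > 0" using D by (simp add: zero_less_mult_iff)
    then show ?thesis using True by (simp add: mult_le_0_iff)
  next
    case False
    then have "D' \<le> \<beta> * D'" using D by simp
    then have "\<alpha> * D < 0" using u ut D'_def by linarith
    then have "\<alpha> < 0" using D by (simp add: mult_less_0_iff)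
    then show ?thesis using False by (simp add: mult_le_0_iff)
  qed
  then have "\<bar>approximant_defect x k\<bar> \<le>
      \<bar>of_int \<alpha> * approximant_defect x k + of_int \<beta> * approximant_defect x (Suc k)\<bar>"
    using approximant_defects(1)[OF k] by (intro abs_lattice_combination_ge) auto
  also have "of_int \<alpha> * approximant_defect x k + of_int \<beta> * approximant_defect x (Suc k)
      = of_int u * x - of_int t"
    unfolding approximant_defect_def ut N_def D_def N'_def D'_def by (simp add: algebra_simps)
  finally show ?thesis .
qed

text \<open>The determinant identity reads \<open>1 = \<bar>D' d - D d'\<bar>\<close> in terms of the defects \<open>d, d'\<close> of the two
  approximants and their denominators \<open>D, D'\<close>. The strict inequality comes from \<open>\<bar>d'\<bar> < \<bar>d\<bar>\<close>,
  as the denominators may coincide (both are 1 when the second partial quotient is 1).\<close>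

lemma approximant_defect_lower:
  assumes k: "k < cf_last_index x"
  shows "1 < 2 * of_int (cf_denom x (Suc k)) * \<bar>approximant_defect x k\<bar>"
proof -
  let ?D = "of_int (cf_denom x k) :: rat" and ?D' = "of_int (cf_denom x (Suc k)) :: rat"
  let ?d = "approximant_defect x k" and ?d' = "approximant_defect x (Suc k)"
  have D: "0 < ?D" "?D \<le> ?D'" using cf_denom_pos cf_denom_mono by simp_all
  have "of_int \<bar>approximant_num x (Suc k) * cf_denom x k
        - approximant_num x k * cf_denom x (Suc k)\<bar> = (1 :: rat)"
    using approximant_determinant[OF k] by simp
  then have "1 = \<bar>?D' * ?d - ?D * ?d'\<bar>"
    by (simp add: approximant_defect_def algebra_simps)
  also have "\<dots> \<le> ?D' * \<bar>?d\<bar> + ?D * \<bar>?d'\<bar>"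
    using D abs_triangle_ineq4[of "?D' * ?d" "?D * ?d'"] by (simp add: abs_mult)
  also have "\<dots> < ?D' * \<bar>?d\<bar> + ?D * \<bar>?d\<bar>"
    using D approximant_defects(2)[OF k] by (intro add_strict_left_mono mult_strict_left_mono)
  also have "\<dots> \<le> ?D' * \<bar>?d\<bar> + ?D' * \<bar>?d\<bar>"
    using D(2) by (intro add_left_mono mult_right_mono) simp_all
  finally show ?thesis by (simp add: mult.commute mult.left_commute)
qed

text \<open>The approximant of index 0 always qualifies, its denominator being 1.\<close>

lemma ex_is_last_approximant_le:
  assumes "B \<ge> 1"
  shows "\<exists>k. is_last_approximant_le x B k"
proof -
  define K where "K = {j. j \<le> cf_last_index x \<and> cf_denom x j \<le> B}"
  have fin: "finite K" unfolding K_def by simp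
  have "0 \<in> K" using assms by (simp add: K_def cf_denom_zero)
  then have "Max K \<in> K" using fin by (intro Max_in) auto
  moreover have "j \<notin> K" if "Max K < j" for j using that fin Max_ge leD by blast
  ultimately obtain k where "k \<in> K" and "\<And>j. k < j \<Longrightarrow> j \<notin> K" by blast
  then show ?thesis by (auto simp: K_def is_last_approximant_le_def)
qed

text \<open>The condition \<open>2 B \<bar>u x - t\<bar> < 1\<close> is a variant of Legendre's criterion, with the common bound \<open>B\<close> on
  the denominators in place of \<open>u\<close>. It yields not only that \<open>t / u\<close> is an approximant, but also
  which one. The fraction \<open>t / u\<close> may be reducible.\<close>

lemma good_approximation_is_last_approximant:
  fixes x :: rat and B t u :: int
  assumes last: "is_last_approximant_le x B k"
    and u: "0 < u" "u \<le> B"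
    and close: "2 * of_int B * \<bar>of_int u * x - of_int t\<bar> < 1"
  shows "of_int t / of_int u = cf_approximant x k"
    and "of_int u * x \<noteq> of_int t \<Longrightarrow> k < cf_last_index x"
    and "k < cf_last_index x \<Longrightarrow>
      1 < 2 * of_int (cf_denom x (Suc k)) * \<bar>of_int u * x - of_int t\<bar>"
proof -
  define c where "c = \<bar>of_int u * x - of_int t\<bar>"
  define N D where "N = approximant_num x k" and "D = cf_denom x k"
  have D: "0 < D" "D \<le> B"
    using last cf_denom_pos by (simp_all add: D_def is_last_approximant_le_def)
  have x_last: "cf_approximant x k = x" if "\<not> k < cf_last_index x"
  proof -
    have "k = cf_last_index x" using that last by (simp add: is_last_approximant_le_def)
    then show ?thesis using cf_approximant_last by simp
  qed
  have best: "\<bar>approximant_defect x k\<bar> \<le> c"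
  proof (cases "k < cf_last_index x")
    case True
    then have "u < cf_denom x (Suc k)"
      using last u by (auto simp: is_last_approximant_le_def not_le intro: le_less_trans)
    then show ?thesis using approximant_best[OF True u(1)] by (simp add: c_def)
  next
    case False
    have "of_int N / of_int D = x"
      using x_last[OF False] by (simp add: cf_approximant_eq_div N_def D_def)
    then have "approximant_defect x k = 0"
      using D by (auto simp: approximant_defect_def N_def[symmetric] D_def[symmetric])
    then show ?thesis by (simp add: c_def)
  qed
  have c0: "0 \<le> c" by (simp add: c_def)
  \<comment> \<open>The cross difference of the two fractions is an integer of absolute value below 1.\<close>
  have "of_int \<bar>t * D - N * u\<bar>
      = \<bar>of_int u * approximant_defect x k - of_int D * (of_int u * x - of_int t)\<bar>"
    by (simp add: approximant_defect_def N_def D_def algebra_simps)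
  also have "\<dots> \<le> of_int u * \<bar>approximant_defect x k\<bar> + of_int D * c"
    using u D abs_triangle_ineq4[of "of_int u * approximant_defect x k"
        "of_int D * (of_int u * x - of_int t)"] by (simp add: abs_mult c_def)
  also have "\<dots> \<le> of_int B * c + of_int B * c"
    using u D best c0 by (intro add_mono mult_mono) auto
  also have "\<dots> < 1" using close by (simp add: c_def)
  finally have "\<bar>t * D - N * u\<bar> < 1" by (simp only: of_int_less_1_iff)
  then have "t * D = N * u" by simp
  then have "of_int t * of_int D = (of_int N * of_int u :: rat)" by (metis of_int_mult)
  then show eq: "of_int t / of_int u = cf_approximant x k"
    using u D by (simp add: cf_approximant_eq_div N_def[symmetric] D_def[symmetric] frac_eq_eq)
  show "k < cf_last_index x" if "of_int u * x \<noteq> of_int t"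
  proof (rule ccontr)
    assume "\<not> k < cf_last_index x"
    then have "of_int t / of_int u = x" using x_last eq by simp
    then show False using that u by auto
  qed
  show "1 < 2 * of_int (cf_denom x (Suc k)) * \<bar>of_int u * x - of_int t\<bar>"
    if "k < cf_last_index x"
  proof -
    have "1 < 2 * of_int (cf_denom x (Suc k)) * \<bar>approximant_defect x k\<bar>"
      using approximant_defect_lower[OF that] .
    also have "\<dots> \<le> 2 * of_int (cf_denom x (Suc k)) * c"
      using best cf_denom_pos[of x "Suc k"] by (intro mult_left_mono) simp_all
    finally show ?thesis by (simp add: c_def)
  qed
qed

section \<open>Rational reconstruction\<close>

theorem theorem3p1:
  fixes X M Mgood Mbad :: int and P Q :: nat
  assumes "M \<ge> 2"
    and "P > 0" and "Q > 0"
    and "Mgood > 0" and "Mbad > 0"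
    and "M = Mgood * Mbad"
    and "2 * int P * int Q * Mbad ^ 2 < M"
    and "\<exists>p q. admissible X Mgood P Q p q"
  shows "(\<exists>!z :: rat. \<exists>p q. admissible X Mgood P Q p q \<and> z = of_int p / of_int q) \<and>
    (\<exists>k. is_last_approximant_le (of_int X / of_int M) (int Q * Mbad) k \<and>
      (\<forall>p q. admissible X Mgood P Q p q \<longrightarrow>
        (of_int p / of_int q :: rat) =
          of_int X - of_int M * cf_approximant (of_int X / of_int M) k \<and>
        (p \<noteq> 0 \<longrightarrow>
          k + 1 \<le> cf_last_index (of_int X / of_int M) \<and>
          (of_int (cf_denom (of_int X / of_int M) (k + 1)) :: rat) >
            of_int Mgood / (2 * of_int \<bar>p\<bar>))))"
proof -
  define x :: rat where "x = of_int X / of_int M"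
  define B where "B = int Q * Mbad"
  have "0 < B" using assms(3,5) by (simp add: B_def)
  then have "B \<ge> 1" by simp
  then obtain k where k: "is_last_approximant_le x B k"
    using ex_is_last_approximant_le by blast
  have main: "(of_int p / of_int q :: rat) = of_int X - of_int M * cf_approximant x k \<and>
      (p \<noteq> 0 \<longrightarrow> k + 1 \<le> cf_last_index x \<and>
        (of_int (cf_denom x (k + 1)) :: rat) > of_int Mgood / (2 * of_int \<bar>p\<bar>))"
    if adm: "admissible X Mgood P Q p q" for p q
  proof -
    have pq: "\<bar>p\<bar> \<le> int P" "1 \<le> q" "q \<le> int Q" "[p = q * X] (mod Mgood)"
      using adm by (auto simp: admissible_def)
    have "Mgood dvd q * X - p"
      using pq(4) by (metis cong_iff_dvd_diff cong_sym)
    then obtain t where t: "q * X - p = Mgood * t" by (elim dvdE)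
    define u where "u = q * Mbad"
    have u: "0 < u" "u \<le> B" using pq assms(5) by (simp_all add: u_def B_def)
    have tr: "of_int q * of_int X - of_int p = (of_int Mgood * of_int t :: rat)"
      using t by (metis of_int_diff of_int_mult)
    have defect: "of_int u * x - of_int t = of_int p / of_int Mgood"
      using tr assms(4,5) by (simp add: u_def x_def assms(6) field_simps)
    \<comment> \<open>The size hypothesis, divided by \<open>Mbad\<close>, is the closeness that the approximation lemma needs.\<close>
    have "2 * B * \<bar>p\<bar> * Mbad \<le> 2 * B * int P * Mbad"
      using pq(1) \<open>0 < B\<close> assms(5) by (intro mult_right_mono mult_left_mono) auto
    also have "\<dots> < Mgood * Mbad"
      using assms(6,7) by (simp add: B_def power2_eq_square mult_ac)
    finally have "2 * B * \<bar>p\<bar> < Mgood" using assms(5) by simp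
    then have "of_int (2 * B * \<bar>p\<bar>) < (of_int Mgood :: rat)" by (simp only: of_int_less_iff)
    then have close: "2 * of_int B * \<bar>of_int u * x - of_int t\<bar> < 1"
      using assms(4) by (simp add: defect abs_divide)
    note core = good_approximation_is_last_approximant[OF k u close]
    have "(of_int p / of_int q :: rat) = of_int X - of_int M * (of_int t / of_int u)"
      using tr pq(2) assms(4,5) by (simp add: u_def assms(6) field_simps)
    moreover have "k + 1 \<le> cf_last_index x \<and>
        (of_int (cf_denom x (k + 1)) :: rat) > of_int Mgood / (2 * of_int \<bar>p\<bar>)" if "p \<noteq> 0"
    proof -
      have "of_int u * x - of_int t \<noteq> 0" using defect that assms(4) by simp
      then have "k < cf_last_index x" using core(2) by simp
      moreover from core(3)[OF this] have
        "of_int Mgood / (2 * of_int \<bar>p\<bar>) < (of_int (cf_denom x (k + 1)) :: rat)"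
        using that assms(4) unfolding defect by (simp add: abs_divide field_simps)
      ultimately show ?thesis by simp
    qed
    ultimately show ?thesis using core(1) by simp
  qed
  have "\<exists>!z :: rat. \<exists>p q. admissible X Mgood P Q p q \<and> z = of_int p / of_int q"
    using assms(8) main by metis
  then show ?thesis using k main unfolding x_def B_def by blast
qed

end
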